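(* Let $s$ be a weak composition and let $T_1\preccurlyeq T_2$ be two $s$-decreasing trees. Then $[T_1,T_2]$ is a pure interval if and only if it is a $+1$-interval and for all $a<b<c$ (and all values $v,w$): (1) if $(c,a)_v\in\operatorname{Var}([T_1,T_2])$ and $(b,a)_w\in\operatorname{Var}([T_1,T_2])$, then $(c,b)_v\in \operatorname{Var}([T_1,T_2])$; (2) if $(c,a)_v\in\operatorname{EVar}([T_1,T_2])$ and $(c,b)_v\in\operatorname{EVar}([T_1,T_2])$ and $s(b)\neq 0$, then $(b,a)_0\in\operatorname{Var}([T_1,T_2])$.
   Context: A weak composition of length $n$ is a sequence $s=(s(1),\dots,s(n))$ of non-negative integers. An $s$-decreasing tree is a rooted planar tree with $n$ internal nodes labeled bijectively by $1,\dots,n$ (leaves are unlabeled) such that node $i$ has exactly $s(i)+1$ ordered children and labels decrease from root to leaves. For a node $y$ of such a tree $T$ with $s(y)=m$, let $T^y_0,\dots,T^y_m$ be the children of $y$ from left to right, where "child" means the whole subtree; a child is empty if it is just a leaf. $T^y_0$ is the left child, $T^y_m$ the right child (strict right child if $m>0$), and $T^y_i$ with $0<i<m$ are the middle children. A descendant of $y$ is a node lying in one of the $T^y_i$. Tree-inversions: for nodes $a<c$, $\#_T(c,a)$ is $0$ if $a$ is left of $c$ or belongs to $T^c_0$; it is $i$ if $a$ belongs to $T^c_i$ with $0<i<s(c)$; it is $s(c)$ if $a$ belongs to $T^c_{s(c)}$ or is right of $c$. $\operatorname{inv}(T)$ is the multi-set in which $(c,a)$ occurs $\#_T(c,a)$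 times; it determines $T$. The $s$-weak order: $R\preccurlyeq T$ iff $\#_R(c,a)\le \#_T(c,a)$ for all $a<c$. Intervals are $[T_1,T_2]=\{R: T_1\preccurlyeq R\preccurlyeq T_2\}$. Transitive closure: for a multi-set $I$ of pairs $(c,a)$, $a<c$, with multiplicities $\#_I(c,a)$, a transitivity path from $c$ to $a$ is a list $c=b_1>\dots>b_k=a$, $k\ge2$, with $\#_I(b_i,b_{i+1})>0$ for all $i$; $\#_{I^{\mathsf{tc}}}(c,a)$ is the maximal value of $\#_I(b_1,b_2)$ over all such paths (and $0$ if there is none). A pair $(a,c)$ with $a<c$ is a tree-ascent of $T$ if: (i) $a$ is a descendant of $c$; (ii) $a$ does not belong to the right child of $c$; (iii) whenever $c>b>a$ and $a$ is a descendant of $b$, $a$ belongs to the right child of $b$; (iv) if $s(a)>0$, the right child of $a$ is empty. For a (possibly empty) set $A$ of tree-ascents of $T$, $T+A$ is the $s$-decreasing tree whose multi-set of tree-inversions is obtained from $\operatorname{inv}(T)$ by increasing $\#_T(c,a)$ by one for every $(a,c)\in A$ and then taking the transitive closure. $[T_1,T_2]$ is a pure interval if $T_2=T_1+A$ for some set $A$ of tree-ascents of $T_1$. Variations: $(c,a)$ with $c>a$ varies in $[T_1,T_2]$ if $\#_{T_2}(c,a)>\#_{T_1}(c,a)$; then $(c,a)_v$ with $v=\#_{T_1}(c,a)$ is a variation of $[T_1,T_2]$ (of value $v$), and its amplitude is $\#_{T_2}(c,a)-\#_{T_1}(c,a)$. A variation $(c,a)_v$ is essential if there is no $b$ with $a<b<c$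 such that $a$ belongs to a middle child of $b$ in $T_1$ and $(c,b)$ varies. $\operatorname{Var}([T_1,T_2])$ and $\operatorname{EVar}([T_1,T_2])$ denote the sets of variations and of essential variations. $[T_1,T_2]$ is a $+1$-interval if all its variations have amplitude one, i.e. $\#_{T_1}(b,a)\le\#_{T_2}(b,a)\le\#_{T_1}(b,a)+1$ for all $a<b$. *)

theory Defs
  imports Main "HOL-Library.Multiset"
begin

datatype tree = Leaf | Node nat "tree list"

fun labels :: "tree \<Rightarrow> nat list" where
  "labels Leaf = []"
| "labels (Node y ts) = y # concat (map labels ts)"

definition nodes :: "tree \<Rightarrow> nat set" where
  "nodes T = set (labels T)"

fun subtrees :: "tree \<Rightarrow> tree set" where
  "subtrees Leaf = {Leaf}"
| "subtrees (Node y ts) = insert (Node y ts) (\<Union>t\<in>set ts. subtrees t)"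

text \<open>
  A weak composition of length \<open>n\<close> is given by \<open>n\<close> together with a function \<open>s\<close>, of which only the
  values \<open>s 1, \<dots>, s n\<close> matter.
\<close>
definition decreasing_tree :: "(nat \<Rightarrow> nat) \<Rightarrow> nat \<Rightarrow> tree \<Rightarrow> bool" where
  "decreasing_tree s n T \<longleftrightarrow>
     distinct (labels T) \<and> nodes T = {1..n} \<and>
     (\<forall>y ts. Node y ts \<in> subtrees T \<longrightarrow>
        length ts = s y + 1 \<and> (\<forall>t\<in>set ts. \<forall>x\<in>nodes t. x < y))"

text \<open>\<open>is_child T y i t\<close>: the subtree \<open>t\<close> is the child \<open>T\<^sup>y\<^sub>i\<close>; it is empty iff \<open>t = Leaf\<close>.\<close>
definition is_child :: "tree \<Rightarrow> nat \<Rightarrow> nat \<Rightarrow> tree \<Rightarrow> bool" where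
  "is_child T y i t \<longleftrightarrow> (\<exists>ts. Node y ts \<in> subtrees T \<and> i < length ts \<and> t = ts ! i)"

text \<open>\<open>in_child T y i x\<close>: the node \<open>x\<close> belongs to \<open>T\<^sup>y\<^sub>i\<close>.\<close>
definition in_child :: "tree \<Rightarrow> nat \<Rightarrow> nat \<Rightarrow> nat \<Rightarrow> bool" where
  "in_child T y i x \<longleftrightarrow> (\<exists>t. is_child T y i t \<and> x \<in> nodes t)"

definition descendant :: "tree \<Rightarrow> nat \<Rightarrow> nat \<Rightarrow> bool" where
  "descendant T y x \<longleftrightarrow> (\<exists>i. in_child T y i x)"

definition in_right_child :: "(nat \<Rightarrow> nat) \<Rightarrow> tree \<Rightarrow> nat \<Rightarrow> nat \<Rightarrow> bool" where
  "in_right_child s T y x \<longleftrightarrow> in_child T y (s y) x"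

definition in_middle_child :: "(nat \<Rightarrow> nat) \<Rightarrow> tree \<Rightarrow> nat \<Rightarrow> nat \<Rightarrow> bool" where
  "in_middle_child s T y x \<longleftrightarrow> (\<exists>i. 0 < i \<and> i < s y \<and> in_child T y i x)"

definition left_of :: "tree \<Rightarrow> nat \<Rightarrow> nat \<Rightarrow> bool" where
  "left_of T a c \<longleftrightarrow> (\<exists>y i j. i < j \<and> in_child T y i a \<and> in_child T y j c)"

text \<open>
  The multiplicity \<open>#\<^sub>T(c,a)\<close>, meaningful for nodes \<open>a < c\<close> of an \<open>s\<close>-decreasing tree \<open>T\<close>. There
  the last case says that \<open>a\<close> is in the right child of \<open>c\<close> or to the right of \<open>c\<close>.
\<close>
definition inv_mult :: "(nat \<Rightarrow> nat) \<Rightarrow> tree \<Rightarrow> nat \<Rightarrow> nat \<Rightarrow> nat" where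
  "inv_mult s T c a =
     (if left_of T a c \<or> in_child T c 0 a then 0
      else if in_middle_child s T c a then (THE i. in_child T c i a)
      else s c)"

definition tree_inversions :: "(nat \<Rightarrow> nat) \<Rightarrow> tree \<Rightarrow> (nat \<times> nat) multiset" where
  "tree_inversions s T =
     (\<Sum>(c, a) \<in> {(c, a). c \<in> nodes T \<and> a \<in> nodes T \<and> a < c}. replicate_mset (inv_mult s T c a) (c, a))"

lemma count_tree_inversions:
  "count (tree_inversions s T) (c, a) =
     (if c \<in> nodes T \<and> a \<in> nodes T \<and> a < c then inv_mult s T c a else 0)"
proof -
  let ?P = "{(c, a). c \<in> nodes T \<and> a \<in> nodes T \<and> a < c}"
  have "finite ?P"
    by (rule finite_subset[of _ "nodes T \<times> nodes T"]) (auto simp: nodes_def)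
  moreover have "count (tree_inversions s T) (c, a) =
      (\<Sum>p\<in>?P. if p = (c, a) then inv_mult s T c a else 0)"
    unfolding tree_inversions_def count_sum by (rule sum.cong) (auto split: if_splits)
  ultimately show ?thesis by simp
qed

definition weak_le :: "(nat \<Rightarrow> nat) \<Rightarrow> tree \<Rightarrow> tree \<Rightarrow> bool" where
  "weak_le s R T \<longleftrightarrow>
     (\<forall>c\<in>nodes R. \<forall>a\<in>nodes R. a < c \<longrightarrow> inv_mult s R c a \<le> inv_mult s T c a)"

definition transitivity_path :: "(nat \<times> nat) multiset \<Rightarrow> nat \<Rightarrow> nat \<Rightarrow> nat list \<Rightarrow> bool" where
  "transitivity_path I c a bs \<longleftrightarrow>
     length bs \<ge> 2 \<and> hd bs = c \<and> last bs = a \<and> sorted_wrt (>) bs \<and>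
     (\<forall>i. Suc i < length bs \<longrightarrow> count I (bs ! i, bs ! Suc i) > 0)"

definition tc_mult :: "(nat \<times> nat) multiset \<Rightarrow> nat \<Rightarrow> nat \<Rightarrow> nat" where
  "tc_mult I c a = Max (insert 0 {count I (bs ! 0, bs ! 1) | bs. transitivity_path I c a bs})"

definition tclosure :: "(nat \<times> nat) multiset \<Rightarrow> (nat \<times> nat) multiset" where
  "tclosure I =
     (\<Sum>(c, a) \<in> fst ` set_mset I \<times> snd ` set_mset I. replicate_mset (tc_mult I c a) (c, a))"

lemma count_tclosure: "count (tclosure I) (c, a) = tc_mult I c a"
proof -
  let ?P = "fst ` set_mset I \<times> snd ` set_mset I"
  have "count (tclosure I) (c, a) = (\<Sum>p\<in>?P. if p = (c, a) then tc_mult I c a else 0)"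
    unfolding tclosure_def count_sum by (rule sum.cong) (auto split: if_splits)
  then have *: "count (tclosure I) (c, a) = (if (c, a) \<in> ?P then tc_mult I c a else 0)"
    by simp
  have "(c, a) \<in> ?P" if path: "transitivity_path I c a bs" for bs
  proof -
    let ?k = "length bs - 2"
    have len: "length bs \<ge> 2" and hd: "hd bs = c" and last: "last bs = a"
      and pos: "Suc i < length bs \<Longrightarrow> (bs ! i, bs ! Suc i) \<in> set_mset I" for i
      using path by (auto simp: transitivity_path_def)
    have "bs \<noteq> []" using len by auto
    have "c = bs ! 0" using hd \<open>bs \<noteq> []\<close> by (simp add: hd_conv_nth)
    moreover have "a = bs ! Suc ?k"
      using last len \<open>bs \<noteq> []\<close> by (simp add: last_conv_nth Suc_diff_Suc numeral_2_eq_2)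
    moreover have "(bs ! 0, bs ! Suc 0) \<in> set_mset I" "(bs ! ?k, bs ! Suc ?k) \<in> set_mset I"
      using pos len by auto
    ultimately show ?thesis by force
  qed
  then have "tc_mult I c a = 0" if "(c, a) \<notin> ?P"
  proof -
    have "{count I (bs ! 0, bs ! 1) | bs. transitivity_path I c a bs} = {}"
      using that \<open>\<And>bs. transitivity_path I c a bs \<Longrightarrow> (c, a) \<in> ?P\<close> by blast
    then show ?thesis by (simp add: tc_mult_def)
  qed
  with * show ?thesis by auto
qed

definition tree_ascent :: "(nat \<Rightarrow> nat) \<Rightarrow> tree \<Rightarrow> nat \<Rightarrow> nat \<Rightarrow> bool" where
  "tree_ascent s T a c \<longleftrightarrow>
     a < c \<and>
     descendant T c a \<and>
     \<not> in_right_child s T c a \<and>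
     (\<forall>b. a < b \<and> b < c \<and> descendant T b a \<longrightarrow> in_right_child s T b a) \<and>
     (s a > 0 \<longrightarrow> is_child T a (s a) Leaf)"

text \<open>
  \<open>is_ascent_sum s n T A R\<close> means \<open>R = T + A\<close>. It is a relation because that an \<open>s\<close>-decreasing tree with
  these tree-inversions exists, and is unique, are theorems rather than part of the definition.
  The pairs \<open>(a, c)\<close> of \<open>A\<close> are reversed to match the convention \<open>(c, a)\<close> for tree-inversions.
\<close>
definition is_ascent_sum ::
    "(nat \<Rightarrow> nat) \<Rightarrow> nat \<Rightarrow> tree \<Rightarrow> (nat \<times> nat) set \<Rightarrow> tree \<Rightarrow> bool" where
  "is_ascent_sum s n T A R \<longleftrightarrow>
     decreasing_tree s n R \<and>
     tree_inversions s R = tclosure (tree_inversions s T + mset_set (prod.swap ` A))"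

text \<open>Intervals \<open>[T\<^sub>1, T\<^sub>2]\<close> are represented by their end points.\<close>
definition pure_interval :: "(nat \<Rightarrow> nat) \<Rightarrow> nat \<Rightarrow> tree \<Rightarrow> tree \<Rightarrow> bool" where
  "pure_interval s n T1 T2 \<longleftrightarrow>
     (\<exists>A. (\<forall>(a, c) \<in> A. tree_ascent s T1 a c) \<and> is_ascent_sum s n T1 A T2)"

definition varies :: "(nat \<Rightarrow> nat) \<Rightarrow> tree \<Rightarrow> tree \<Rightarrow> nat \<Rightarrow> nat \<Rightarrow> bool" where
  "varies s T1 T2 c a \<longleftrightarrow>
     c \<in> nodes T1 \<and> a \<in> nodes T1 \<and> a < c \<and> inv_mult s T2 c a > inv_mult s T1 c a"

text \<open>The variation \<open>(c,a)\<^sub>v\<close> is the triple \<open>(c, a, v)\<close>.\<close>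
definition Var :: "(nat \<Rightarrow> nat) \<Rightarrow> tree \<Rightarrow> tree \<Rightarrow> (nat \<times> nat \<times> nat) set" where
  "Var s T1 T2 = {(c, a, v). varies s T1 T2 c a \<and> v = inv_mult s T1 c a}"

definition amplitude :: "(nat \<Rightarrow> nat) \<Rightarrow> tree \<Rightarrow> tree \<Rightarrow> nat \<Rightarrow> nat \<Rightarrow> nat" where
  "amplitude s T1 T2 c a = inv_mult s T2 c a - inv_mult s T1 c a"

definition EVar :: "(nat \<Rightarrow> nat) \<Rightarrow> tree \<Rightarrow> tree \<Rightarrow> (nat \<times> nat \<times> nat) set" where
  "EVar s T1 T2 =
     {(c, a, v) \<in> Var s T1 T2.
        \<not> (\<exists>b. a < b \<and> b < c \<and> in_middle_child s T1 b a \<and> varies s T1 T2 c b)}"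

definition plus_one_interval :: "(nat \<Rightarrow> nat) \<Rightarrow> tree \<Rightarrow> tree \<Rightarrow> bool" where
  "plus_one_interval s T1 T2 \<longleftrightarrow> (\<forall>(c, a, v) \<in> Var s T1 T2. amplitude s T1 T2 c a = 1)"

end

theory Submission
  imports Defs
begin

text \<open>
  The argument is carried out on the multiplicities \<open>x c a = #\<^sub>T(c,a)\<close> alone. For a decreasing tree
  they are bounded by \<open>s c\<close>, transitive and planar (\<open>inversion_table\<close>), and they encode the tree: \<open>a\<close>
  is in the \<open>i\<close>-th child of \<open>c\<close> iff \<open>x c a = i\<close> and no \<open>d > c\<close> has \<open>x d a \<noteq> x d c\<close>
  (\<open>in_child_iff_inv_mult\<close>). So tree-ascents and essential variations can be expressed by
  multiplicities. Transitive closure is replaced by the recursion that splits off the first step of a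
  path (\<open>is_tc\<close>). Let \<open>x\<close> and \<open>y\<close> be the multiplicities of \<open>T\<^sub>1\<close> and \<open>T\<^sub>2\<close>.

  Suppose \<open>T\<^sub>2 = T\<^sub>1 + A\<close>. Seen from any larger node, a transitivity path moves weakly to the right, so
  \<open>(c, a)\<close> varies only if some \<open>(e, c) \<in> A\<close> has \<open>x c e = x c a\<close> and \<open>a\<close> equals \<open>e\<close> or is reached from
  \<open>e\<close>, and then it grows by one (\<open>variation_witness\<close>). The definition of an ascent makes \<open>e\<close> a
  rightmost node in its child of \<open>c\<close> (\<open>ascent_maximal\<close>). Both conditions follow from
  this by induction on \<open>c\<close>, the induction step going from \<open>c\<close> to \<open>e\<close>.

  Conversely, let \<open>A\<close> consist of the tree-ascents \<open>(a, c)\<close> of \<open>T\<^sub>1\<close> for which \<open>(c, a)\<close> varies. Since \<open>y\<close> is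
  transitive, it is enough that each variation \<open>(c, a)\<^sub>v\<close> is inherited from a variation \<open>(c, b)\<^sub>v\<close> with
  \<open>(b, c) \<in> A\<close>, in the sense that \<open>b = a\<close> or \<open>y b a > 0\<close>. The largest \<open>b\<close> from which it is inherited is
  such a node (\<open>variation_below_ascent\<close>).
\<close>

section \<open>Inversion tables\<close>

text \<open>
  The properties of the multiplicities \<open>x c a = #\<^sub>T(c,a)\<close> of a decreasing tree on which the argument
  rests. Transitivity: if \<open>0 < x b a\<close>, so that \<open>a\<close> is to the right of \<open>b\<close> or in a child of \<open>b\<close> other than
  the left one, then seen from \<open>c\<close> it is not to the left of \<open>b\<close>. Planarity is the mirror image of this.
\<close>
locale inversion_table =
  fixes s :: "nat \<Rightarrow> nat" and x :: "nat \<Rightarrow> nat \<Rightarrow> nat"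
  assumes supp: "0 < x c a \<Longrightarrow> a < c"
    and bound: "x c a \<le> s c"
    and transitive: "a < b \<Longrightarrow> b < c \<Longrightarrow> 0 < x b a \<Longrightarrow> x c b \<le> x c a"
    and planar: "a < b \<Longrightarrow> b < c \<Longrightarrow> x b a < s b \<Longrightarrow> x c a \<le> x c b"
begin

text \<open>
  For \<open>a < c\<close> the node \<open>a\<close> is a descendant of \<open>c\<close>, in the child with index \<open>x c a\<close>, iff no larger
  node separates them.
\<close>
definition desc :: "nat \<Rightarrow> nat \<Rightarrow> bool" where
  "desc c a \<longleftrightarrow> (\<forall>d>c. x d a = x d c)"

lemma descD: "desc c a \<Longrightarrow> c < d \<Longrightarrow> x d a = x d c"
  by (simp add: desc_def)

lemma desc_comparable: "desc c a \<Longrightarrow> desc b a \<Longrightarrow> b < c \<Longrightarrow> desc c b"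
  by (simp add: desc_def)

lemma middle_desc: "0 < x c a \<Longrightarrow> x c a < s c \<Longrightarrow> desc c a"
  unfolding desc_def using supp transitive planar by (metis le_antisym)

text \<open>Tree-ascents, expressed by the multiplicities; the argument order is that of \<open>tree_ascent\<close>.\<close>
definition ascent :: "nat \<Rightarrow> nat \<Rightarrow> bool" where
  "ascent a c \<longleftrightarrow> a < c \<and> desc c a \<and> x c a < s c \<and>
     (\<forall>b. a < b \<and> b < c \<and> desc b a \<longrightarrow> x b a = s b) \<and>
     (s a > 0 \<longrightarrow> \<not> (\<exists>e<a. desc a e \<and> x a e = s a))"

text \<open>
  If \<open>(p, c)\<close> is an ascent, then \<open>p\<close> is weakly to the right of all other nodes \<open>q\<close> of its child of \<open>c\<close>,
  as seen from any node larger than both: the largest node \<open>m\<close> that sees \<open>p\<close> strictly to the left of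
  \<open>q\<close> would be smaller than \<open>c\<close> and have \<open>p\<close> as a descendant outside its right child.
\<close>
lemma ascent_maximal:
  assumes asc: "ascent p c" and q: "desc c q" "x c q = x c p" and d: "p < d" "q < d"
  shows "x d q \<le> x d p"
proof (rule ccontr)
  let ?S = "{d. p < d \<and> q < d \<and> x d p < x d q}"
  assume "\<not> x d q \<le> x d p"
  then have dS: "d \<in> ?S" using d by auto
  have below: "e < c" if "e \<in> ?S" for e
  proof (rule ccontr)
    assume "\<not> e < c"
    then consider "e = c" | "c < e" by linarith
    then show False
      using that q asc descD[of c] by cases (auto simp: ascent_def)
  qed
  then have fin: "finite ?S" by (intro finite_subset[of ?S "{..<c}"]) auto
  define m where "m = Max ?S"
  have m: "m \<in> ?S" unfolding m_def using Max_in[OF fin] dS by blast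
  have m_max: "e \<le> m" if "e \<in> ?S" for e unfolding m_def using Max_ge[OF fin] that by blast
  have "x m p < s m" using m bound[of m q] by auto
  have "desc m p"
    unfolding desc_def
  proof (intro allI impI antisym)
    fix e assume e: "m < e"
    show "x e p \<le> x e m" using planar m e \<open>x m p < s m\<close> by blast
    have "x e m \<le> x e q" using transitive[of q m e] m e by auto
    also have "x e q \<le> x e p" using m_max[of e] e m by force
    finally show "x e m \<le> x e p" .
  qed
  with asc m below[OF m] \<open>x m p < s m\<close> show False by (auto simp: ascent_def)
qed

end

section \<open>Transitive closure as a recursion\<close>

text \<open>
  \<open>is_tc z y\<close>: the table \<open>y\<close> is the transitive closure of \<open>z\<close>. A path from \<open>c\<close> to \<open>a\<close> with first step
  \<open>(c, b)\<close> continues by a path from \<open>b\<close> to \<open>a\<close>, unless \<open>b = a\<close>, and such a path exists iff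
  \<open>0 < y b a\<close>.
\<close>
definition is_tc :: "(nat \<Rightarrow> nat \<Rightarrow> nat) \<Rightarrow> (nat \<Rightarrow> nat \<Rightarrow> nat) \<Rightarrow> bool" where
  "is_tc z y \<longleftrightarrow> (\<forall>c a v. 0 < v \<longrightarrow>
     (v \<le> y c a \<longleftrightarrow> (\<exists>b. a \<le> b \<and> b < c \<and> v \<le> z c b \<and> (b = a \<or> 0 < y b a))))"

lemma is_tcD:
  "is_tc z y \<Longrightarrow> 0 < v \<Longrightarrow>
     v \<le> y c a \<longleftrightarrow> (\<exists>b. a \<le> b \<and> b < c \<and> v \<le> z c b \<and> (b = a \<or> 0 < y b a))"
  unfolding is_tc_def by blast

lemma is_tc_unique:
  assumes "is_tc z y" and "is_tc z y'"
  shows "y c a = y' c a"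
proof (induction c rule: less_induct)
  case (less c)
  have "v \<le> y c a \<longleftrightarrow> v \<le> y' c a" if "0 < v" for v
    unfolding is_tcD[OF assms(1) that] is_tcD[OF assms(2) that] using less by auto
  then show ?case
    by (metis bot_nat_0.extremum le_antisym neq0_conv order_refl)
qed

lemma transitivity_path_Cons:
  "transitivity_path I c a (c' # bs) \<longleftrightarrow>
     c' = c \<and> (\<exists>b. b < c \<and> 0 < count I (c, b) \<and> hd bs = b \<and>
       (bs = [a] \<or> transitivity_path I b a bs))"
proof (cases bs)
  case Nil
  then show ?thesis by (simp add: transitivity_path_def)
next
  case (Cons b bs')
  show ?thesis
  proof (cases "bs' = []")
    case True
    then show ?thesis using Cons by (auto simp: transitivity_path_def)
  next
    case False
    have all: "(\<forall>i. Suc i < length (c' # bs) \<longrightarrow> 0 < count I ((c' # bs) ! i, (c' # bs) ! Suc i)) \<longleftrightarrow>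
      0 < count I (c', b) \<and> (\<forall>i. Suc i < length bs \<longrightarrow> 0 < count I (bs ! i, bs ! Suc i))"
      (is "?L \<longleftrightarrow> ?R")
    proof
      assume L: ?L
      show ?R using L[rule_format, of 0] L[rule_format, of "Suc _"] Cons by auto
    next
      assume R: ?R
      show ?L
      proof (intro allI impI)
        fix i assume "Suc i < length (c' # bs)"
        then show "0 < count I ((c' # bs) ! i, (c' # bs) ! Suc i)"
          using R Cons by (cases i) auto
      qed
    qed
    show ?thesis
      unfolding transitivity_path_def all
      using Cons False by (cases bs') (auto simp: Suc_le_eq)
  qed
qed

lemma tc_mult_ge_iff:
  assumes "0 < v"
  shows "v \<le> tc_mult I c a \<longleftrightarrow>
    (\<exists>bs. transitivity_path I c a bs \<and> v \<le> count I (bs ! 0, bs ! 1))"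
proof -
  let ?V = "{count I (bs ! 0, bs ! 1) | bs. transitivity_path I c a bs}"
  have "?V \<subseteq> count I ` set_mset I"
    by (force simp: transitivity_path_def)
  then have "finite ?V" by (rule finite_subset) simp
  then show ?thesis
    unfolding tc_mult_def using assms by (subst Max_ge_iff) auto
qed

lemma is_tc_tc_mult: "is_tc (\<lambda>c a. count I (c, a)) (tc_mult I)"
  unfolding is_tc_def
proof (intro allI impI)
  fix c a v :: nat
  assume v: "0 < v"
  have pos: "0 < tc_mult I b a \<longleftrightarrow> (\<exists>bs. transitivity_path I b a bs)" for b
  proof -
    have "0 < count I (bs ! 0, bs ! 1)" if "transitivity_path I b a bs" for bs
      using that by (auto simp: transitivity_path_def)
    then show ?thesis using tc_mult_ge_iff[of 1 I b a] by (auto simp: Suc_le_eq)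
  qed
  have ge: "a < b" if "transitivity_path I b a bs" for b bs
    using that by (cases bs) (auto simp: transitivity_path_def)
  have hd: "transitivity_path I b a bs \<Longrightarrow> hd bs = b \<and> bs \<noteq> [] \<and> bs ! 0 = b" for b bs
    by (cases bs) (auto simp: transitivity_path_def)
  show "v \<le> tc_mult I c a \<longleftrightarrow>
      (\<exists>b. a \<le> b \<and> b < c \<and> v \<le> count I (c, b) \<and> (b = a \<or> 0 < tc_mult I b a))"
    unfolding tc_mult_ge_iff[OF v]
  proof
    assume "\<exists>bs. transitivity_path I c a bs \<and> v \<le> count I (bs ! 0, bs ! 1)"
    then obtain bs where bs: "transitivity_path I c a bs" "v \<le> count I (bs ! 0, bs ! 1)" by blast
    then obtain bs' where bs': "bs = c # bs'"
      by (metis hd list.collapse)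
    from bs(1)[unfolded bs' transitivity_path_Cons] obtain b
      where b: "b < c" "hd bs' = b" "bs' = [a] \<or> transitivity_path I b a bs'" by blast
    then have "bs' ! 0 = b" using hd by auto
    then show "\<exists>b. a \<le> b \<and> b < c \<and> v \<le> count I (c, b) \<and> (b = a \<or> 0 < tc_mult I b a)"
      using b bs(2) pos ge bs' by (intro exI[of _ b]) (auto simp: less_imp_le)
  next
    assume "\<exists>b. a \<le> b \<and> b < c \<and> v \<le> count I (c, b) \<and> (b = a \<or> 0 < tc_mult I b a)"
    then obtain b where b: "b < c" "v \<le> count I (c, b)" "b = a \<or> 0 < tc_mult I b a" by blast
    then obtain bs where bs: "bs = [a] \<and> b = a \<or> transitivity_path I b a bs"
      using pos by blast
    then have "hd bs = b" "bs ! 0 = b" using hd by auto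
    then have "transitivity_path I c a (c # bs)" "v \<le> count I ((c # bs) ! 0, (c # bs) ! 1)"
      unfolding transitivity_path_Cons using b bs v \<open>hd bs = b\<close> by (auto dest!: order_less_le_trans[of 0 v "count I (c, b)"])
    then show "\<exists>bs. transitivity_path I c a bs \<and> v \<le> count I (bs ! 0, bs ! 1)" by blast
  qed
qed

section \<open>Variations of a pure interval\<close>

text \<open>
  A variation \<open>(c,a)\<^sub>v\<close> is essential if no \<open>b\<close> between \<open>a\<close> and \<open>c\<close> has \<open>a\<close> in a middle child and
  varies with \<open>c\<close>. Nodes in a middle child are recognised by \<open>0 < x b a < s b\<close>.
\<close>
definition essential ::
    "(nat \<Rightarrow> nat) \<Rightarrow> (nat \<Rightarrow> nat \<Rightarrow> nat) \<Rightarrow> (nat \<Rightarrow> nat \<Rightarrow> nat) \<Rightarrow> nat \<Rightarrow> nat \<Rightarrow> bool" where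
  "essential s x y c a \<longleftrightarrow>
     \<not> (\<exists>b. a < b \<and> b < c \<and> 0 < x b a \<and> x b a < s b \<and> x c b < y c b)"

text \<open>Here \<open>y\<close> is the table of \<open>T + A\<close> for a tree \<open>T\<close> with table \<open>x\<close> and a set \<open>A\<close> of ascents.\<close>
locale ascent_closure = X: inversion_table s x + Y: inversion_table s y
  for s x y +
  fixes A :: "(nat \<times> nat) set"
  assumes asc: "(a, c) \<in> A \<Longrightarrow> X.ascent a c"
    and tc: "is_tc (\<lambda>c a. x c a + of_bool ((a, c) \<in> A)) y"
begin

lemma closure_ge: "x c a + of_bool ((a, c) \<in> A) \<le> y c a" if "a < c"
  using is_tcD[OF tc, of "x c a + of_bool ((a, c) \<in> A)" c a] that
  by (cases "x c a + of_bool ((a, c) \<in> A) = 0") auto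

text \<open>
  Both kinds of steps of a transitivity path leaving \<open>b\<close> (positive entries of \<open>x\<close>, and ascents) move
  weakly to the right as seen from a larger node \<open>c\<close>.
\<close>
lemma positive_mono: "0 < y b a \<Longrightarrow> b < c \<Longrightarrow> x c b \<le> x c a"
proof (induction b rule: less_induct)
  case (less b)
  then obtain e where e: "a \<le> e" "e < b" "1 \<le> x b e + of_bool ((e, b) \<in> A)" "e = a \<or> 0 < y e a"
    using is_tcD[OF tc, of 1 b a] by (auto simp: Suc_le_eq)
  have "x c b \<le> x c e"
  proof (cases "(e, b) \<in> A")
    case True
    then show ?thesis using asc X.descD less.prems by (fastforce simp: X.ascent_def)
  next
    case False
    then show ?thesis using X.transitive e less.prems by auto
  qed
  also have "x c e \<le> x c a" using e less by auto
  finally show ?case .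
qed

text \<open>Hence an entry \<open>(c, a)\<close> can only grow by one, along a path that starts with an ascent in \<open>A\<close>.\<close>
lemma variation_witness:
  assumes var: "x c a < y c a"
  obtains e where "(e, c) \<in> A" "a \<le> e" "e < c" "x c e = x c a" "e = a \<or> 0 < y e a"
    "y c a = Suc (x c a)"
proof -
  obtain e where e: "a \<le> e" "e < c" "y c a \<le> x c e + of_bool ((e, c) \<in> A)" "e = a \<or> 0 < y e a"
    using is_tcD[OF tc, of "y c a" c a] var by auto
  have "x c e \<le> x c a" using e positive_mono by auto
  with e(3) var have "(e, c) \<in> A" "x c e = x c a" "y c a = Suc (x c a)"
    by (auto split: if_splits simp: of_bool_def)
  with e that show ?thesis by blast
qed

lemma variation_desc:
  assumes var: "x c a < y c a"
  shows "X.desc c a"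
  unfolding X.desc_def
proof (intro allI impI antisym)
  fix d assume d: "c < d"
  have "x c a < s c" using var Y.bound[of c a] by simp
  with d var Y.supp[of c a] show "x d a \<le> x d c" by (intro X.planar) auto
  obtain e where e: "(e, c) \<in> A" "e < c" "e = a \<or> 0 < y e a" using variation_witness[OF var] by metis
  have "x d c = x d e" using asc[OF e(1)] d by (simp add: X.ascent_def X.desc_def)
  also have "\<dots> \<le> x d a" using e positive_mono d by auto
  finally show "x d c \<le> x d a" .
qed

lemma closure_var:
  assumes "(e, c) \<in> A" "e = b \<or> 0 < y e b" "x c b = x c e"
  shows "x c b < y c b"
proof -
  have "e < c" using asc[OF assms(1)] by (simp add: X.ascent_def)
  moreover have "b \<le> e" using assms(2) Y.supp[of e b] by auto
  ultimately have "Suc (x c e) \<le> y c b"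
    using is_tcD[OF tc, of "Suc (x c e)" c b] assms by auto
  then show ?thesis using assms by simp
qed

lemma condition1:
  assumes "a < b" "b < c" "x c a < y c a" "x b a < y b a"
  shows "x c b = x c a \<and> x c b < y c b"
  using assms
proof (induction c rule: less_induct)
  case (less c)
  note ab = \<open>a < b\<close> and bc = \<open>b < c\<close>
  have Dca: "X.desc c a" and Dba: "X.desc b a" using less.prems variation_desc by auto
  have val: "x d b = x d a" if "b < d" for d using X.descD[OF Dba that] by simp
  obtain e where e: "(e, c) \<in> A" "a \<le> e" "e < c" "x c e = x c a" "e = a \<or> 0 < y e a"
    using variation_witness[OF less.prems(3)] by metis
  \<comment> \<open>Otherwise \<open>b\<close> and all larger nodes see \<open>e\<close> and \<open>a\<close> alike, so that \<open>e\<close> is a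
    descendant of \<open>b\<close> outside its right child, and \<open>(e, c)\<close> is no ascent.\<close>
  have eb: "b \<le> e"
  proof (rule ccontr)
    assume "\<not> b \<le> e"
    then have "e < b" by simp
    have "x d e = x d a" if "b \<le> d" for d
    proof (rule antisym)
      show "x d a \<le> x d e"
        using X.ascent_maximal[OF asc[OF e(1)] Dca, of d] e \<open>e < b\<close> ab that by simp
      show "x d e \<le> x d a"
        using e(5) positive_mono[of e a d] \<open>e < b\<close> that by auto
    qed
    then have "X.desc b e" "x b e = x b a" using Dba by (auto simp: X.desc_def)
    moreover have "x b a < s b" using less.prems(4) Y.bound[of b a] by simp
    ultimately show False using asc[OF e(1)] \<open>e < b\<close> bc by (auto simp: X.ascent_def)
  qed
  have "e = b \<or> 0 < y e b"
  proof (cases "e = b")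
    case False
    then have be: "b < e" using eb by simp
    have yea: "0 < y e a" using e(5) be ab by auto
    show ?thesis
    proof (cases "x e a = 0")
      case True
      then show ?thesis using less.IH[OF e(3) ab be] yea less.prems(4) by auto
    next
      case False
      then show ?thesis using val[OF be] closure_ge[OF be] by simp
    qed
  qed simp
  with closure_var[OF e(1)] val[OF bc] e(4) show ?case by simp
qed

text \<open>
  For an essential variation, the node \<open>a\<close> below the ascending node \<open>e\<close> has multiplicity \<open>0\<close> at \<open>e\<close>:
  it is in no middle child of \<open>e\<close>, the right child of \<open>e\<close> is empty, and \<open>a\<close> is not to the right of \<open>e\<close>.
  So \<open>(e, a)\<close> varies as well.
\<close>
lemma essential_witness:
  assumes var: "x c a < y c a" and ess: "essential s x y c a"
  obtains e where "(e, c) \<in> A" "a \<le> e" "x c e = x c a"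
    "e = a \<or> a < e \<and> x e a = 0 \<and> 0 < y e a"
proof -
  obtain e where e: "(e, c) \<in> A" "a \<le> e" "e < c" "x c e = x c a" "e = a \<or> 0 < y e a"
    using variation_witness[OF var] by metis
  have "x e a = 0" if ae: "a < e"
  proof (rule ccontr)
    assume "x e a \<noteq> 0"
    then have pos: "0 < x e a" by simp
    have asc_e: "X.ascent e c" using asc[OF e(1)] .
    have "x c e < y c e" using closure_var[OF e(1)] by blast
    then have right: "x e a = s e"
      using ess e ae pos X.bound[of e a] by (force simp: essential_def)
    \<comment> \<open>In its child of \<open>c\<close> nothing lies to the right of \<open>e\<close>, so \<open>a\<close> would lie in the empty right child of \<open>e\<close>.\<close>
    have "X.desc e a"
      unfolding X.desc_def
    proof (intro allI impI antisym)
      fix d assume d: "e < d"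
      show "x d e \<le> x d a" using X.transitive[OF ae d pos] .
      show "x d a \<le> x d e"
        using X.ascent_maximal[OF asc_e variation_desc[OF var]] e d ae by simp
    qed
    with right pos asc_e ae show False by (auto simp: X.ascent_def)
  qed
  with e that show ?thesis by (metis le_neq_implies_less)
qed

lemma condition2:
  assumes "a < b" "b < c" "x c a < y c a" "x c b < y c b" "x c a = x c b"
    and "essential s x y c a" "essential s x y c b" "s b \<noteq> 0"
  shows "x b a = 0 \<and> 0 < y b a"
  using assms
proof (induction c rule: less_induct)
  case (less c)
  note ab = \<open>a < b\<close> and bc = \<open>b < c\<close>
  obtain e where e: "(e, c) \<in> A" "a \<le> e" "x c e = x c a" "e = a \<or> a < e \<and> x e a = 0 \<and> 0 < y e a"
    using essential_witness[OF less.prems(3,6)] by metis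
  obtain f where f: "(f, c) \<in> A" "b \<le> f" "x c f = x c b" "f = b \<or> b < f \<and> x f b = 0 \<and> 0 < y f b"
    using essential_witness[OF less.prems(4,7)] by metis
  \<comment> \<open>Of two ascending nodes in the same child of \<open>c\<close>, the smaller one is in the right child of the
    larger one, which is nonempty only if the larger one has just one child.\<close>
  have unary: "s q = 0" if pq: "(p, c) \<in> A" "(q, c) \<in> A" "p < q" "x c p = x c q" for p q
  proof (rule ccontr)
    assume "s q \<noteq> 0"
    have p: "X.ascent p c" and q: "X.ascent q c" using pq asc by auto
    then have D: "X.desc c p" "X.desc c q" by (auto simp: X.ascent_def)
    have "X.desc q p"
      unfolding X.desc_def
      using X.ascent_maximal[OF p D(2)] X.ascent_maximal[OF q D(1)] pq by (simp add: antisym)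
    moreover have "x q p = s q"
      using p q \<open>X.desc q p\<close> pq(3) by (auto simp: X.ascent_def)
    ultimately show False using q pq(3) \<open>s q \<noteq> 0\<close> by (auto simp: X.ascent_def)
  qed
  have pos: "0 < s p" if "0 < y p q" for p q using that Y.bound[of p q] by simp
  consider "e < f" | "f < e" | "e = f" by linarith
  then show ?case
  proof cases
    case 1
    then have "s f = 0" using unary[OF e(1) f(1)] e f less.prems by simp
    then show ?thesis using f(4) less.prems(8) pos by fastforce
  next
    case 2
    then have "s e = 0" using unary[OF f(1) e(1)] e f less.prems by simp
    then show ?thesis using e(4) 2 f(2) ab pos[of e a] by auto
  next
    case 3
    show ?thesis
    proof (cases "e = b")
      case True
      then show ?thesis using e ab by auto
    next
      case False
      with 3 f e ab have e': "b < e" "x e a = 0" "0 < y e a" "x e b = 0" "0 < y e b" by auto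
      have ec: "e < c" using asc[OF e(1)] by (simp add: X.ascent_def)
      \<comment> \<open>A node of the same child of \<open>c\<close> as \<open>e\<close> that varies with \<open>e\<close> also varies with \<open>c\<close>, so what is
        essential for \<open>c\<close> is essential for \<open>e\<close>.\<close>
      have ess: "essential s x y e g" if g: "essential s x y c g" "x c g = x c e" for g
        unfolding essential_def
      proof
        assume "\<exists>h. g < h \<and> h < e \<and> 0 < x h g \<and> x h g < s h \<and> x e h < y e h"
        then obtain h where h: "g < h" "h < e" "0 < x h g" "x h g < s h" "x e h < y e h" by blast
        have "x c h = x c e" using X.middle_desc[OF h(3,4)] h ec g(2) X.descD by force
        then have "x c h < y c h" using closure_var[OF e(1), of h] h by auto
        then show False using g(1) h ec unfolding essential_def by force
      qed
      show ?thesis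
        using less.IH[OF ec ab e'(1)] e' ess less.prems e(3) by simp
    qed
  qed
qed

end

section \<open>Intervals that satisfy the conditions\<close>

text \<open>
  Two tables \<open>x \<le> y\<close> that form a \<open>+1\<close>-interval and satisfy both conditions on variations, the first
  one without its claim on the value of \<open>(c, b)\<close>, which is not needed here.
\<close>
locale variation_conditions = X: inversion_table s x + Y: inversion_table s y
  for s x y +
  assumes le: "x c a \<le> y c a"
    and amplitude_one: "y c a \<le> Suc (x c a)"
    and cond1: "a < b \<Longrightarrow> b < c \<Longrightarrow> x c a < y c a \<Longrightarrow> x b a < y b a \<Longrightarrow> x c b < y c b"
    and cond2: "a < b \<Longrightarrow> b < c \<Longrightarrow> x c a < y c a \<Longrightarrow> x c b < y c b \<Longrightarrow> x c a = x c b \<Longrightarrow>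
       essential s x y c a \<Longrightarrow> essential s x y c b \<Longrightarrow> s b \<noteq> 0 \<Longrightarrow> x b a = 0 \<and> x b a < y b a"
begin

lemma variation_desc:
  assumes var: "x c a < y c a"
  shows "X.desc c a"
  unfolding X.desc_def
proof (intro allI impI)
  fix d assume d: "c < d"
  have ac: "a < c" and "x c a < s c" using var Y.bound[of c a] Y.supp[of c a] by simp_all
  then have ub: "x d a \<le> x d c" using X.planar d by blast
  show "x d a = x d c"
  proof (rule ccontr)
    assume "x d a \<noteq> x d c"
    with ub have lt: "x d a < x d c" by simp
    have "y d c \<le> y d a" using Y.transitive[OF ac d] var by simp
    then have "x d a < y d a" "x d c = y d c"
      using lt le[of d c] amplitude_one[of d a] by simp_all
    with cond1[OF ac d _ var] show False by simp
  qed
qed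

text \<open>
  The witness \<open>b\<close> is the largest node from which the increase of \<open>(c, a)\<close> can be inherited, that is,
  with \<open>b = a\<close> or \<open>0 < y b a\<close> and such that \<open>(c, b)\<close> varies with the same value; maximality
  makes \<open>(c, b)\<close> essential. The first and second conditions then show that \<open>b\<close> is in the right child
  of every node strictly between \<open>b\<close> and \<open>c\<close> that it is a descendant of, and the second one that the
  right child of \<open>b\<close> is empty if \<open>s b > 0\<close>.
\<close>
lemma variation_below_ascent:
  assumes var: "x c a < y c a"
  obtains b where "a \<le> b" "b < c" "X.ascent b c" "x c b = x c a" "x c b < y c b"
    "b = a \<or> 0 < y b a"
proof -
  let ?S = "{b. a \<le> b \<and> b < c \<and> x c b = x c a \<and> x c b < y c b \<and> (b = a \<or> 0 < y b a)}"
  have fin: "finite ?S" by simp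
  have "a \<in> ?S" using var Y.supp[of c a] by simp
  define b where "b = Max ?S"
  have "?S \<noteq> {}" using \<open>a \<in> ?S\<close> by (metis (no_types) empty_iff)
  then have b: "b \<in> ?S" unfolding b_def by (rule Max_in[OF fin])
  have b_max: "e \<le> b" if "e \<in> ?S" for e unfolding b_def by (rule Max_ge[OF fin that])
  have bc: "b < c" and vb: "x c b < y c b" using b by auto
  have Dcb: "X.desc c b" using variation_desc[OF vb] .
  have above: "y e b = 0" if e: "b < e" "e < c" "x c e = x c b" "x c e < y c e" for e
  proof (rule ccontr)
    assume "y e b \<noteq> 0"
    then have "0 < y e a" using Y.transitive[of a b e] Y.supp[of b a] b e by auto
    then show False using b_max[of e] b e by auto
  qed
  have ess: "essential s x y c b"
    unfolding essential_def
  proof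
    assume "\<exists>e. b < e \<and> e < c \<and> 0 < x e b \<and> x e b < s e \<and> x c e < y c e"
    then obtain e where e: "b < e" "e < c" "0 < x e b" "x e b < s e" "x c e < y c e" by blast
    have "x c e = x c b" using X.descD[OF X.middle_desc[OF e(3,4)] e(2)] by (rule sym)
    then show False using above[OF e(1,2) _ e(5)] e(3) le[of e b] by simp
  qed
  have right: "x e b = s e" if e: "b < e" "e < c" "X.desc e b" for e
  proof (rule ccontr)
    assume "x e b \<noteq> s e"
    then have lt: "x e b < s e" using X.bound[of e b] by simp
    have val: "x c e = x c b" using X.descD[OF e(3) e(2)] by (rule sym)
    have var_e: "x c e < y c e"
    proof (cases "y e b < s e")
      case True
      then have "y c b \<le> y c e" using Y.planar[OF e(1,2)] by blast
      then show ?thesis using vb val by simp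
    next
      case False
      then have "x e b < y e b" using lt by simp
      then show ?thesis using cond1[OF e(1,2) vb] by simp
    qed
    have "y e b = 0" using above[OF e(1,2) val var_e] .
    moreover have "essential s x y c e"
      unfolding essential_def
    proof
      assume "\<exists>h. e < h \<and> h < c \<and> 0 < x h e \<and> x h e < s h \<and> x c h < y c h"
      then obtain h where h: "e < h" "h < c" "0 < x h e" "x h e < s h" "x c h < y c h" by blast
      have "x h b = x h e" using X.descD[OF e(3) h(1)] .
      then show False using ess h e(1) unfolding essential_def by (metis order_less_trans)
    qed
    ultimately show False
      using cond2[OF e(1,2) vb var_e _ ess] val lt by simp
  qed
  have empty: "\<not> (\<exists>g<b. X.desc b g \<and> x b g = s b)" if sb: "s b > 0"
  proof
    let ?G = "{g. g < b \<and> X.desc b g \<and> x b g = s b}"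
    assume "\<exists>g<b. X.desc b g \<and> x b g = s b"
    then have ne: "?G \<noteq> {}" by blast
    have finG: "finite ?G" by simp
    \<comment> \<open>The root of the right child, which is in no middle child of another node of the right child.\<close>
    define g where "g = Max ?G"
    have g: "g \<in> ?G" unfolding g_def using Max_in[OF finG ne] .
    have g_max: "h \<le> g" if "h \<in> ?G" for h unfolding g_def by (rule Max_ge[OF finG that])
    have val: "x c g = x c b" using X.descD[of b g c] g bc by simp
    have "0 < y b g" using g sb le[of b g] by auto
    then have "y c b \<le> y c g" using Y.transitive g bc by blast
    then have vg: "x c g < y c g" using vb val by simp
    have "essential s x y c g"
      unfolding essential_def
    proof
      assume "\<exists>h. g < h \<and> h < c \<and> 0 < x h g \<and> x h g < s h \<and> x c h < y c h"
      then obtain h where h: "g < h" "h < c" "0 < x h g" "x h g < s h" "x c h < y c h" by blast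
      have Dhg: "X.desc h g" using X.middle_desc h by blast
      consider "h < b" | "h = b" | "b < h" by linarith
      then show False
      proof cases
        case 1
        then have "X.desc b h" using X.desc_comparable Dhg g by blast
        moreover have "x b h = s b" using X.descD[OF Dhg 1] g by simp
        ultimately show False using g_max[of h] 1 h(1) by simp
      next
        case 2
        then show False using h g by simp
      next
        case 3
        have "x h b = x h g" using g X.descD[of b g h] 3 by simp
        then show False using ess h 3 unfolding essential_def by metis
      qed
    qed
    then have "x b g = 0" using cond2[of g b c] g bc vg vb val ess sb by auto
    then show False using g sb by simp
  qed
  have "X.ascent b c"
    unfolding X.ascent_def using bc Dcb vb Y.bound[of c b] right empty by auto
  with b that show ?thesis by auto
qed

lemma closure_of_varying_ascents:
  "is_tc (\<lambda>c a. x c a + of_bool (x c a < y c a \<and> X.ascent a c)) y"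
  unfolding is_tc_def
proof (intro allI impI iffI)
  fix c a v :: nat
  assume v: "0 < v" and vy: "v \<le> y c a"
  show "\<exists>b. a \<le> b \<and> b < c \<and> v \<le> x c b + of_bool (x c b < y c b \<and> X.ascent b c) \<and> (b = a \<or> 0 < y b a)"
  proof (cases "x c a < y c a")
    case False
    then show ?thesis using v vy le[of c a] Y.supp[of c a] by (intro exI[of _ a]) auto
  next
    case True
    then obtain b where "a \<le> b" "b < c" "X.ascent b c" "x c b = x c a" "x c b < y c b"
      "b = a \<or> 0 < y b a" by (rule variation_below_ascent)
    then show ?thesis using vy amplitude_one[of c a] by (intro exI[of _ b]) auto
  qed
next
  fix c a v :: nat
  assume "\<exists>b. a \<le> b \<and> b < c \<and> v \<le> x c b + of_bool (x c b < y c b \<and> X.ascent b c) \<and> (b = a \<or> 0 < y b a)"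
  then obtain b where b: "b < c" "v \<le> x c b + of_bool (x c b < y c b \<and> X.ascent b c)"
    "b = a \<or> 0 < y b a" by blast
  have "v \<le> y c b" using b(2) le[of c b] by (auto simp: of_bool_def split: if_splits)
  also have "y c b \<le> y c a" using b Y.transitive[of a b c] Y.supp[of b a] by auto
  finally show "v \<le> y c a" .
qed

end

section \<open>Tree-inversions of decreasing trees\<close>

text \<open>
  The property of being \<open>s\<close>-decreasing without the requirement that the labels are \<open>1, \<dots>, n\<close>. Unlike
  \<^const>\<open>decreasing_tree\<close> it passes to subtrees, which makes induction on trees possible.
\<close>
definition locally_decreasing :: "(nat \<Rightarrow> nat) \<Rightarrow> tree \<Rightarrow> bool" where
  "locally_decreasing s T \<longleftrightarrow> distinct (labels T) \<and>
     (\<forall>y ts. Node y ts \<in> subtrees T \<longrightarrow>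
        length ts = s y + 1 \<and> (\<forall>t\<in>set ts. \<forall>x\<in>nodes t. x < y))"

lemma nodes_Leaf [simp]: "nodes Leaf = {}"
  by (simp add: nodes_def)

lemma nodes_Node: "nodes (Node y ts) = insert y (\<Union>k<length ts. nodes (ts ! k))"
  by (force simp: nodes_def in_set_conv_nth)

lemma subtrees_refl [simp]: "T \<in> subtrees T"
  by (cases T) auto

text \<open>
  The indices are compared rather than the children, since several children may be equal leaves.
\<close>
lemma distinct_concat_labels:
  "distinct (concat (map labels ts)) \<Longrightarrow> i < length ts \<Longrightarrow> j < length ts \<Longrightarrow>
     x \<in> nodes (ts ! i) \<Longrightarrow> x \<in> nodes (ts ! j) \<Longrightarrow> i = j"
proof (induction ts arbitrary: i j)
  case (Cons t ts)
  have "x \<notin> nodes (ts ! k)" if "x \<in> nodes t" "k < length ts" for k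
  proof -
    have "set (labels t) \<inter> set (concat (map labels ts)) = {}" using Cons.prems(1) by simp
    moreover have "nodes (ts ! k) \<subseteq> set (concat (map labels ts))"
      using nth_mem[OF that(2)] by (auto simp: nodes_def)
    ultimately show ?thesis using that(1) unfolding nodes_def by blast
  qed
  moreover have "distinct (concat (map labels ts))" using Cons.prems(1) by simp
  ultimately show ?case
    using Cons.IH Cons.prems(2-) by (cases i; cases j) auto
qed simp

context
  fixes s y ts
  assumes dec: "locally_decreasing s (Node y ts)"
begin

lemma length_children: "length ts = Suc (s y)"
  using dec by (simp add: locally_decreasing_def)

lemma child_less: "k < length ts \<Longrightarrow> a \<in> nodes (ts ! k) \<Longrightarrow> a < y"
  using dec nth_mem unfolding locally_decreasing_def by (metis subtrees_refl)

lemma child_locally_decreasing: "t \<in> set ts \<Longrightarrow> locally_decreasing s t"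
proof -
  assume t: "t \<in> set ts"
  then have "subtrees t \<subseteq> subtrees (Node y ts)" by auto
  moreover have "distinct (labels t)"
    using dec t by (simp add: locally_decreasing_def distinct_concat_iff)
  ultimately show ?thesis using dec unfolding locally_decreasing_def by blast
qed

lemma child_disjoint:
  "i < length ts \<Longrightarrow> j < length ts \<Longrightarrow> a \<in> nodes (ts ! i) \<Longrightarrow> a \<in> nodes (ts ! j) \<Longrightarrow> i = j"
  using dec distinct_concat_labels[of ts i j a] by (simp add: locally_decreasing_def)

end

lemma in_child_Leaf [simp]: "\<not> in_child Leaf c i a"
  by (simp add: in_child_def is_child_def)

lemma in_child_Node:
  "in_child (Node y ts) c i a \<longleftrightarrow>
     c = y \<and> i < length ts \<and> a \<in> nodes (ts ! i) \<or> (\<exists>k<length ts. in_child (ts ! k) c i a)"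
proof -
  have sub: "Node c us \<in> subtrees (Node y ts) \<longleftrightarrow>
      c = y \<and> us = ts \<or> (\<exists>k<length ts. Node c us \<in> subtrees (ts ! k))" for us
    by simp (metis in_set_conv_nth)
  show ?thesis unfolding in_child_def is_child_def sub by blast
qed

lemma in_child_nodes: "in_child T c i a \<Longrightarrow> c \<in> nodes T \<and> a \<in> nodes T"
proof (induction T)
  case (Node y ts)
  from Node.prems consider "c = y" "i < length ts" "a \<in> nodes (ts ! i)"
    | k where "k < length ts" "in_child (ts ! k) c i a"
    unfolding in_child_Node by blast
  then show ?case
  proof cases
    case 1
    then show ?thesis by (auto simp: nodes_Node)
  next
    case (2 k)
    then show ?thesis using Node.IH[of "ts ! k"] by (auto simp: nodes_Node)
  qed
qed simp

context
  fixes s y ts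
  assumes dec: "locally_decreasing s (Node y ts)"
begin

lemma in_child_root: "in_child (Node y ts) y i a \<longleftrightarrow> i < length ts \<and> a \<in> nodes (ts ! i)"
proof -
  have "\<not> in_child (ts ! k) y i a" if "k < length ts" for k
    using in_child_nodes[of "ts ! k" y i a] child_less[OF dec that, of y] by auto
  then show ?thesis by (auto simp: in_child_Node)
qed

lemma in_child_inner:
  assumes "k < length ts" "c \<in> nodes (ts ! k)"
  shows "in_child (Node y ts) c i a \<longleftrightarrow> in_child (ts ! k) c i a"
proof -
  have "c \<noteq> y" using child_less[OF dec assms] by simp
  moreover have "l = k" if "l < length ts" "in_child (ts ! l) c i a" for l
    using child_disjoint[OF dec that(1) assms(1) _ assms(2)] in_child_nodes[OF that(2)] by simp
  ultimately show ?thesis using assms(1) by (auto simp: in_child_Node)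
qed

lemma left_of_Node:
  "left_of (Node y ts) a c \<longleftrightarrow>
     (\<exists>i j. i < j \<and> j < length ts \<and> a \<in> nodes (ts ! i) \<and> c \<in> nodes (ts ! j)) \<or>
     (\<exists>k<length ts. left_of (ts ! k) a c)"
proof
  assume "left_of (Node y ts) a c"
  then obtain d i j where d: "i < j" "in_child (Node y ts) d i a" "in_child (Node y ts) d j c"
    by (auto simp: left_of_def)
  show "(\<exists>i j. i < j \<and> j < length ts \<and> a \<in> nodes (ts ! i) \<and> c \<in> nodes (ts ! j)) \<or>
     (\<exists>k<length ts. left_of (ts ! k) a c)"
  proof (cases "d = y")
    case True
    then show ?thesis using d by (auto simp: in_child_root)
  next
    case False
    then obtain k where k: "k < length ts" "d \<in> nodes (ts ! k)"
      using in_child_nodes[OF d(2)] by (auto simp: nodes_Node)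
    then have "left_of (ts ! k) a c"
      using d unfolding left_of_def in_child_inner[OF k] by blast
    then show ?thesis using k by blast
  qed
next
  assume "(\<exists>i j. i < j \<and> j < length ts \<and> a \<in> nodes (ts ! i) \<and> c \<in> nodes (ts ! j)) \<or>
     (\<exists>k<length ts. left_of (ts ! k) a c)"
  then consider i j where "i < j" "j < length ts" "a \<in> nodes (ts ! i)" "c \<in> nodes (ts ! j)"
    | k where "k < length ts" "left_of (ts ! k) a c" by blast
  then show "left_of (Node y ts) a c"
  proof cases
    case (1 i j)
    then show ?thesis
      unfolding left_of_def by (intro exI[of _ y] exI[of _ i] exI[of _ j]) (simp add: in_child_root)
  next
    case (2 k)
    then show ?thesis unfolding left_of_def in_child_Node by blast
  qed
qed

end

lemma left_of_nodes: "left_of T a c \<Longrightarrow> a \<in> nodes T \<and> c \<in> nodes T"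
  unfolding left_of_def using in_child_nodes by blast

lemma in_child_unique:
  assumes "locally_decreasing s T" "in_child T c i a" "in_child T c j a"
  shows "i = j"
  using assms
proof (induction T)
  case (Node y ts)
  note dec = Node.prems(1)
  show ?case
  proof (cases "c = y")
    case True
    then show ?thesis using Node.prems in_child_root[OF dec] child_disjoint[OF dec] by auto
  next
    case False
    then obtain k where k: "k < length ts" "c \<in> nodes (ts ! k)"
      using in_child_nodes[OF Node.prems(2)] by (auto simp: nodes_Node)
    then show ?thesis
      using Node.IH[of "ts ! k"] Node.prems child_locally_decreasing[OF dec] in_child_inner[OF dec k]
      by auto
  qed
qed simp

lemma inv_mult_le:
  assumes "locally_decreasing s T"
  shows "inv_mult s T c a \<le> s c"
proof (cases "in_middle_child s T c a")
  case True
  then obtain i where "i < s c" "in_child T c i a" by (auto simp: in_middle_child_def)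
  moreover from this have "(THE i. in_child T c i a) = i"
    using in_child_unique[OF assms] by blast
  ultimately show ?thesis by (simp add: inv_mult_def)
qed (simp add: inv_mult_def)

context
  fixes s y ts
  assumes dec: "locally_decreasing s (Node y ts)"
begin

lemma inv_mult_root:
  assumes "i < length ts" "a \<in> nodes (ts ! i)"
  shows "inv_mult s (Node y ts) y a = i"
proof -
  have root: "in_child (Node y ts) y j a \<longleftrightarrow> j = i" for j
    using in_child_root[OF dec, of j a] assms child_disjoint[OF dec _ assms(1) _ assms(2), of j] by auto
  have "\<not> left_of (Node y ts) a y"
    unfolding left_of_Node[OF dec] using left_of_nodes[of _ a y] child_less[OF dec, of _ y] by auto
  moreover have "i \<le> s y" using assms(1) length_children[OF dec] by simp
  ultimately show ?thesis by (auto simp: inv_mult_def in_middle_child_def root)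
qed

lemma inv_mult_same_child:
  assumes k: "k < length ts" "c \<in> nodes (ts ! k)" "a \<in> nodes (ts ! k)"
  shows "inv_mult s (Node y ts) c a = inv_mult s (ts ! k) c a"
proof -
  have a: "l = k" if "l < length ts" "a \<in> nodes (ts ! l)" for l
    using child_disjoint[OF dec that(1) k(1) that(2) k(3)] .
  have c: "l = k" if "l < length ts" "c \<in> nodes (ts ! l)" for l
    using child_disjoint[OF dec that(1) k(1) that(2) k(2)] .
  have "left_of (Node y ts) a c \<longleftrightarrow> left_of (ts ! k) a c"
    unfolding left_of_Node[OF dec]
  proof
    assume "(\<exists>i j. i < j \<and> j < length ts \<and> a \<in> nodes (ts ! i) \<and> c \<in> nodes (ts ! j)) \<or>
      (\<exists>l<length ts. left_of (ts ! l) a c)"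
    then consider i j where "i < j" "j < length ts" "a \<in> nodes (ts ! i)" "c \<in> nodes (ts ! j)"
      | l where "l < length ts" "left_of (ts ! l) a c" by blast
    then show "left_of (ts ! k) a c"
    proof cases
      case (1 i j)
      then show ?thesis using a[of i] c[of j] by simp
    next
      case (2 l)
      then show ?thesis using a[of l] left_of_nodes[of "ts ! l" a c] by simp
    qed
  qed (use k(1) in blast)
  then show ?thesis
    unfolding inv_mult_def in_middle_child_def in_child_inner[OF dec k(1,2)] by simp
qed

lemma inv_mult_distinct_children:
  assumes "i < length ts" "a \<in> nodes (ts ! i)" "k < length ts" "c \<in> nodes (ts ! k)" "i \<noteq> k"
  shows "inv_mult s (Node y ts) c a = (if i < k then 0 else s c)"
proof -
  have a: "l = i" if "l < length ts" "a \<in> nodes (ts ! l)" for l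
    using child_disjoint[OF dec that(1) assms(1) that(2) assms(2)] .
  have c: "l = k" if "l < length ts" "c \<in> nodes (ts ! l)" for l
    using child_disjoint[OF dec that(1) assms(3) that(2) assms(4)] .
  have "\<not> in_child (Node y ts) c j a" for j
    using in_child_inner[OF dec assms(3,4)] in_child_nodes[of "ts ! k" c j a] a[of k] assms by auto
  moreover have "left_of (Node y ts) a c \<longleftrightarrow> i < k"
    unfolding left_of_Node[OF dec]
  proof
    assume "(\<exists>i j. i < j \<and> j < length ts \<and> a \<in> nodes (ts ! i) \<and> c \<in> nodes (ts ! j)) \<or>
      (\<exists>l<length ts. left_of (ts ! l) a c)"
    then consider i' j' where "i' < j'" "j' < length ts" "a \<in> nodes (ts ! i')" "c \<in> nodes (ts ! j')"
      | l where "l < length ts" "left_of (ts ! l) a c" by blast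
    then show "i < k"
    proof cases
      case (1 i' j')
      then show ?thesis using a[of i'] c[of j'] by simp
    next
      case (2 l)
      then show ?thesis using a[of l] c[of l] left_of_nodes[of "ts ! l" a c] assms(5) by simp
    qed
  qed (use assms in blast)
  ultimately show ?thesis by (simp add: inv_mult_def in_middle_child_def)
qed

end

lemma inv_mult_transitive_planar:
  assumes "locally_decreasing s T" "a \<in> nodes T" "b \<in> nodes T" "c \<in> nodes T" "a < b" "b < c"
  shows "(0 < inv_mult s T b a \<longrightarrow> inv_mult s T c b \<le> inv_mult s T c a) \<and>
    (inv_mult s T b a < s b \<longrightarrow> inv_mult s T c a \<le> inv_mult s T c b)"
  using assms
proof (induction T)
  case (Node y ts)
  note dec = Node.prems(1)
  have "c \<le> y"
    using Node.prems(4) child_less[OF dec] by (auto simp: nodes_Node intro: less_imp_le)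
  then have "a \<noteq> y" "b \<noteq> y" using Node.prems(5,6) by auto
  then obtain i j where i: "i < length ts" "a \<in> nodes (ts ! i)" and j: "j < length ts" "b \<in> nodes (ts ! j)"
    using Node.prems by (auto simp: nodes_Node)
  show ?case
  proof (cases "c = y")
    case True
    show ?thesis
      unfolding True inv_mult_root[OF dec i] inv_mult_root[OF dec j]
      using inv_mult_distinct_children[OF dec i j] by (cases i j rule: linorder_cases) auto
  next
    case False
    then obtain k where k: "k < length ts" "c \<in> nodes (ts ! k)"
      using Node.prems by (auto simp: nodes_Node)
    show ?thesis
    proof (cases "i = k \<and> j = k")
      case True
      then show ?thesis
        using Node.IH[of "ts ! k"] i j k child_locally_decreasing[OF dec] Node.prems(5,6)
          inv_mult_same_child[OF dec k(1)] by simp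
    next
      case False
      have "inv_mult s (Node y ts) c a \<le> s c" "inv_mult s (Node y ts) c b \<le> s c"
        using inv_mult_le[OF dec] by auto
      then show ?thesis
        using False inv_mult_distinct_children[OF dec i k] inv_mult_distinct_children[OF dec j k]
          inv_mult_distinct_children[OF dec i j]
        by (cases i j rule: linorder_cases; cases i k rule: linorder_cases;
            cases j k rule: linorder_cases) auto
    qed
  qed
qed simp

text \<open>
  Being a descendant can be read off the tree-inversions: a larger node \<open>d\<close> that separates \<open>a\<close> from
  \<open>c\<close>, such as their lowest common ancestor, sees them with different multiplicities.
\<close>
lemma in_child_iff_inv_mult:
  assumes "locally_decreasing s T" "a \<in> nodes T" "c \<in> nodes T" "a < c"
  shows "in_child T c i a \<longleftrightarrow>
    inv_mult s T c a = i \<and> (\<forall>d\<in>nodes T. c < d \<longrightarrow> inv_mult s T d a = inv_mult s T d c)"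
  using assms
proof (induction T)
  case (Node y ts)
  note dec = Node.prems(1)
  have below: "d \<le> y" if "d \<in> nodes (Node y ts)" for d
    using that child_less[OF dec] by (auto simp: nodes_Node intro: less_imp_le)
  then have "a \<noteq> y" using Node.prems(3,4) by force
  then obtain j where j: "j < length ts" "a \<in> nodes (ts ! j)"
    using Node.prems by (auto simp: nodes_Node)
  show ?case
  proof (cases "c = y")
    case True
    then show ?thesis
      using inv_mult_root[OF dec j] in_child_root[OF dec] j child_disjoint[OF dec] below
      by (metis leD)
  next
    case False
    then obtain k where k: "k < length ts" "c \<in> nodes (ts ! k)"
      using Node.prems by (auto simp: nodes_Node)
    show ?thesis
    proof (cases "j = k")
      case True
      have "(\<forall>d\<in>nodes (Node y ts). c < d \<longrightarrow> inv_mult s (Node y ts) d a = inv_mult s (Node y ts) d c)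
        \<longleftrightarrow> (\<forall>d\<in>nodes (ts ! k). c < d \<longrightarrow> inv_mult s (ts ! k) d a = inv_mult s (ts ! k) d c)"
        (is "?L \<longleftrightarrow> ?R")
      proof
        assume L: ?L
        show ?R
        proof (intro ballI impI)
          fix d assume d: "d \<in> nodes (ts ! k)" "c < d"
          then have "d \<in> nodes (Node y ts)" using k by (auto simp: nodes_Node)
          then show "inv_mult s (ts ! k) d a = inv_mult s (ts ! k) d c"
            using L d j k True inv_mult_same_child[OF dec k(1)] by auto
        qed
      next
        assume R: ?R
        show ?L
        proof (intro ballI impI)
          fix d assume d: "d \<in> nodes (Node y ts)" "c < d"
          then consider "d = y" | l where "l < length ts" "d \<in> nodes (ts ! l)"
            by (auto simp: nodes_Node)
          then show "inv_mult s (Node y ts) d a = inv_mult s (Node y ts) d c"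
          proof cases
            case 1
            then show ?thesis using j k True inv_mult_root[OF dec k(1)] by simp
          next
            case (2 l)
            show ?thesis
            proof (cases "l = k")
              case True
              then show ?thesis
                using 2 R d j k \<open>j = k\<close> inv_mult_same_child[OF dec k(1)] by auto
            next
              case False
              then show ?thesis
                using inv_mult_distinct_children[OF dec j 2] inv_mult_distinct_children[OF dec k 2]
                  \<open>j = k\<close> by simp
            qed
          qed
        qed
      qed
      then show ?thesis
        using Node.IH[of "ts ! k"] True j k child_locally_decreasing[OF dec] Node.prems(4)
          in_child_inner[OF dec k] inv_mult_same_child[OF dec k] by simp
    next
      case False
      \<comment> \<open>The root separates \<open>a\<close> from \<open>c\<close>.\<close>
      have "inv_mult s (Node y ts) y a \<noteq> inv_mult s (Node y ts) y c"
        using inv_mult_root[OF dec j] inv_mult_root[OF dec k] False by simp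
      moreover have "c < y" using child_less[OF dec k] .
      moreover have "\<not> in_child (Node y ts) c i a"
        using in_child_inner[OF dec k] in_child_nodes child_disjoint[OF dec] j k False by blast
      moreover have "y \<in> nodes (Node y ts)" by (simp add: nodes_Node)
      ultimately show ?thesis by blast
    qed
  qed
qed simp

lemma nodes_iff_subtree: "y \<in> nodes T \<longleftrightarrow> (\<exists>ts. Node y ts \<in> subtrees T)"
proof (induction T)
  case (Node z us)
  have "t \<in> set us \<Longrightarrow> y \<in> nodes t \<longleftrightarrow> (\<exists>ts. Node y ts \<in> subtrees t)" for t
    using Node.IH .
  then have "(\<exists>t\<in>set us. y \<in> nodes t) \<longleftrightarrow> (\<exists>ts. \<exists>t\<in>set us. Node y ts \<in> subtrees t)" by blast
  moreover have "y \<in> nodes (Node z us) \<longleftrightarrow> y = z \<or> (\<exists>t\<in>set us. y \<in> nodes t)"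
    by (auto simp: nodes_def)
  ultimately show ?case by simp blast
qed simp

lemma subtree_unique:
  assumes "locally_decreasing s T" "Node y ts \<in> subtrees T" "Node y ts' \<in> subtrees T"
  shows "ts = ts'"
  using assms
proof (induction T)
  case (Node z us)
  note dec = Node.prems(1)
  have y: "y \<in> nodes t" if "Node y vs \<in> subtrees t" for t vs
    using that nodes_iff_subtree by blast
  have sub: "y = z \<and> vs = us \<or> (\<exists>k<length us. Node y vs \<in> subtrees (us ! k))"
    if "Node y vs \<in> subtrees (Node z us)" for vs
    using that by simp (metis in_set_conv_nth)
  show ?case
  proof (cases "y = z")
    case True
    then have "\<not> Node y vs \<in> subtrees (us ! k)" if "k < length us" for k vs
      using y[of vs "us ! k"] child_less[OF dec that, of y] by auto
    then have eq: "vs = us" if "Node y vs \<in> subtrees (Node z us)" for vs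
      using sub[OF that] by blast
    show ?thesis using eq[OF Node.prems(2)] eq[OF Node.prems(3)] by simp
  next
    case False
    then obtain k l where "k < length us" "Node y ts \<in> subtrees (us ! k)"
      "l < length us" "Node y ts' \<in> subtrees (us ! l)"
      using sub[OF Node.prems(2)] sub[OF Node.prems(3)] by blast
    moreover from this have "k = l"
      using child_disjoint[OF dec, of k l y] y[of ts "us ! k"] y[of ts' "us ! l"] by blast
    ultimately show ?thesis
      using Node.IH[of "us ! k"] child_locally_decreasing[OF dec] by simp
  qed
qed simp

section \<open>Translation between trees and inversion tables\<close>

text \<open>
  The multiplicities of \<open>inv(T)\<close> as a function, which vanishes at all pairs that are not pairs
  \<open>(c, a)\<close> of nodes with \<open>a < c\<close>. With this default value the axioms of \<^locale>\<open>inversion_table\<close> hold for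
  all natural numbers, and so do not have to be relativised to nodes.
\<close>
definition inv_table :: "(nat \<Rightarrow> nat) \<Rightarrow> tree \<Rightarrow> nat \<Rightarrow> nat \<Rightarrow> nat" where
  "inv_table s T c a = count (tree_inversions s T) (c, a)"

context
  fixes s n T
  assumes dec: "decreasing_tree s n T"
begin

lemma decreasing_tree_locally_decreasing: "locally_decreasing s T"
  using dec by (simp add: decreasing_tree_def locally_decreasing_def)

lemma nodes_decreasing_tree: "nodes T = {1..n}"
  using dec by (simp add: decreasing_tree_def)

lemma table_inside: "a < c \<Longrightarrow> 1 \<le> a \<Longrightarrow> c \<le> n \<Longrightarrow> inv_table s T c a = inv_mult s T c a"
  unfolding inv_table_def count_tree_inversions by (simp add: nodes_decreasing_tree)

lemma table_outside: "\<not> (a < c \<and> 1 \<le> a \<and> c \<le> n) \<Longrightarrow> inv_table s T c a = 0"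
  unfolding inv_table_def count_tree_inversions by (auto simp: nodes_decreasing_tree)

lemma inversion_table_inv_table: "inversion_table s (inv_table s T)"
proof
  fix a b c :: nat
  show "0 < inv_table s T c a \<Longrightarrow> a < c" using table_outside[of a c] by force
  show "inv_table s T c a \<le> s c"
    using table_inside[of a c] table_outside[of a c] inv_mult_le[OF decreasing_tree_locally_decreasing]
    by (cases "a < c \<and> 1 \<le> a \<and> c \<le> n") auto
  assume abc: "a < b" "b < c"
  consider "1 \<le> a" "c \<le> n" | "a = 0" | "n < c" by linarith
  then have "(0 < inv_table s T b a \<longrightarrow> inv_table s T c b \<le> inv_table s T c a) \<and>
    (inv_table s T b a < s b \<longrightarrow> inv_table s T c a \<le> inv_table s T c b)"
  proof cases
    case 1
    then show ?thesis
      using abc inv_mult_transitive_planar[OF decreasing_tree_locally_decreasing, of a b c]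
      by (simp add: nodes_decreasing_tree table_inside)
  qed (simp_all add: table_outside)
  then show "0 < inv_table s T b a \<Longrightarrow> inv_table s T c b \<le> inv_table s T c a"
    and "inv_table s T b a < s b \<Longrightarrow> inv_table s T c a \<le> inv_table s T c b" by auto
qed

interpretation inversion_table s "inv_table s T" by (rule inversion_table_inv_table)

lemma in_child_iff_table:
  assumes "a < c" "1 \<le> a" "c \<le> n"
  shows "in_child T c i a \<longleftrightarrow> inv_table s T c a = i \<and> desc c a"
proof -
  have "desc c a \<longleftrightarrow> (\<forall>d\<in>nodes T. c < d \<longrightarrow> inv_mult s T d a = inv_mult s T d c)"
  proof -
    have "inv_table s T d a = inv_table s T d c \<longleftrightarrow>
        (d \<in> nodes T \<longrightarrow> inv_mult s T d a = inv_mult s T d c)" if "c < d" for d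
      using that assms by (cases "d \<le> n")
        (simp_all add: nodes_decreasing_tree table_inside table_outside)
    then show ?thesis unfolding desc_def by blast
  qed
  then show ?thesis
    using in_child_iff_inv_mult[OF decreasing_tree_locally_decreasing, of a c i] assms
    by (simp add: nodes_decreasing_tree table_inside)
qed

lemma descendant_iff_table:
  "a < c \<Longrightarrow> 1 \<le> a \<Longrightarrow> c \<le> n \<Longrightarrow> descendant T c a \<longleftrightarrow> desc c a"
  unfolding descendant_def using in_child_iff_table by blast

lemma in_middle_child_iff_table:
  assumes "a < c" "1 \<le> a" "c \<le> n"
  shows "in_middle_child s T c a \<longleftrightarrow> 0 < inv_table s T c a \<and> inv_table s T c a < s c"
  unfolding in_middle_child_def in_child_iff_table[OF assms] using middle_desc[of c a] by auto

lemma right_child_empty_iff: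
  assumes "1 \<le> a" "a \<le> n" "0 < s a"
  shows "is_child T a (s a) Leaf \<longleftrightarrow> \<not> (\<exists>e<a. desc a e \<and> inv_table s T a e = s a)"
proof -
  have a: "a \<in> nodes T" using assms by (simp add: nodes_decreasing_tree)
  obtain ts where ts: "Node a ts \<in> subtrees T" using nodes_iff_subtree[of a T] a by blast
  then have len: "s a < length ts"
    using decreasing_tree_locally_decreasing by (simp add: locally_decreasing_def)
  moreover have "Node a us \<in> subtrees T \<longleftrightarrow> us = ts" for us
    using ts subtree_unique[OF decreasing_tree_locally_decreasing ts, of us] by auto
  ultimately have child: "is_child T a (s a) t \<longleftrightarrow> t = ts ! s a" for t
    unfolding is_child_def by simp
  then have "in_child T a (s a) e \<longleftrightarrow> e \<in> nodes (ts ! s a)" for e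
    by (simp add: in_child_def)
  moreover have "is_child T a (s a) Leaf \<longleftrightarrow> nodes (ts ! s a) = {}"
    unfolding child by (cases "ts ! s a") (simp_all add: nodes_Node)
  moreover have "in_child T a (s a) e \<longleftrightarrow> e < a \<and> desc a e \<and> inv_table s T a e = s a" for e
  proof (cases "e < a \<and> 1 \<le> e")
    case True
    then show ?thesis using in_child_iff_table[of e a] assms(2) by auto
  next
    case False
    have "e < a \<and> 1 \<le> e" if "in_child T a (s a) e"
    proof -
      have "e \<in> nodes (ts ! s a)" using that calculation by simp
      then have "e < a"
        using ts decreasing_tree_locally_decreasing nth_mem[OF len]
        unfolding locally_decreasing_def by blast
      moreover have "e \<in> nodes T" using in_child_nodes[OF that] by simp
      ultimately show ?thesis by (simp add: nodes_decreasing_tree)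
    qed
    then show ?thesis using False assms table_outside[of e a] by auto
  qed
  ultimately show ?thesis by auto
qed

lemma tree_ascent_iff_table:
  assumes "a < c" "1 \<le> a" "c \<le> n"
  shows "tree_ascent s T a c \<longleftrightarrow> ascent a c"
proof -
  have "(\<forall>b. a < b \<and> b < c \<and> descendant T b a \<longrightarrow> in_right_child s T b a) \<longleftrightarrow>
      (\<forall>b. a < b \<and> b < c \<and> desc b a \<longrightarrow> inv_table s T b a = s b)"
    using assms by (simp add: in_right_child_def descendant_iff_table in_child_iff_table cong: conj_cong)
  moreover have "descendant T c a \<and> \<not> in_right_child s T c a \<longleftrightarrow> desc c a \<and> inv_table s T c a < s c"
    using assms bound[of c a] by (auto simp: in_right_child_def descendant_iff_table in_child_iff_table)
  moreover have "(s a > 0 \<longrightarrow> is_child T a (s a) Leaf) \<longleftrightarrow>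
      (s a > 0 \<longrightarrow> \<not> (\<exists>e<a. desc a e \<and> inv_table s T a e = s a))"
    using right_child_empty_iff[of a] assms by auto
  ultimately show ?thesis
    unfolding tree_ascent_def ascent_def using assms(1) by blast
qed

end

lemma varies_iff_table:
  assumes "decreasing_tree s n T1" "decreasing_tree s n T2"
  shows "varies s T1 T2 c a \<longleftrightarrow> inv_table s T1 c a < inv_table s T2 c a"
proof (cases "a < c \<and> 1 \<le> a \<and> c \<le> n")
  case True
  then show ?thesis
    using assms by (simp add: varies_def nodes_decreasing_tree table_inside)
next
  case False
  then show ?thesis
    using assms table_outside[OF assms(2) False] by (auto simp: varies_def nodes_decreasing_tree)
qed

lemma Var_iff_table:
  assumes "decreasing_tree s n T1" "decreasing_tree s n T2"
  shows "(c, a, v) \<in> Var s T1 T2 \<longleftrightarrow>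
    inv_table s T1 c a < inv_table s T2 c a \<and> v = inv_table s T1 c a"
proof -
  have "inv_mult s T1 c a = inv_table s T1 c a" if "varies s T1 T2 c a"
    using that assms by (simp add: varies_def nodes_decreasing_tree table_inside)
  then show ?thesis
    using varies_iff_table[OF assms] by (auto simp: Var_def)
qed

lemma EVar_iff_table:
  assumes "decreasing_tree s n T1" "decreasing_tree s n T2"
  shows "(c, a, v) \<in> EVar s T1 T2 \<longleftrightarrow>
    (c, a, v) \<in> Var s T1 T2 \<and> essential s (inv_table s T1) (inv_table s T2) c a"
proof -
  have "in_middle_child s T1 b a \<longleftrightarrow> 0 < inv_table s T1 b a \<and> inv_table s T1 b a < s b"
    if "(c, a, v) \<in> Var s T1 T2" "a < b" "b < c" for b
    using that assms
    by (intro in_middle_child_iff_table[OF assms(1)])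
      (auto simp: Var_def varies_def nodes_decreasing_tree)
  then show ?thesis
    using varies_iff_table[OF assms] unfolding EVar_def essential_def by blast
qed

lemma plus_one_interval_iff_table:
  assumes "decreasing_tree s n T1" "decreasing_tree s n T2"
  shows "plus_one_interval s T1 T2 \<longleftrightarrow> (\<forall>c a. inv_table s T2 c a \<le> Suc (inv_table s T1 c a))"
proof -
  have "plus_one_interval s T1 T2 \<longleftrightarrow>
      (\<forall>c a. varies s T1 T2 c a \<longrightarrow> inv_mult s T2 c a - inv_mult s T1 c a = 1)"
    by (auto simp: plus_one_interval_def Var_def amplitude_def)
  also have "\<dots> \<longleftrightarrow> (\<forall>c a. inv_table s T1 c a < inv_table s T2 c a \<longrightarrow> inv_table s T2 c a - inv_table s T1 c a = 1)"
  proof -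
    have "inv_mult s T c a = inv_table s T c a" if "varies s T1 T2 c a" "T = T1 \<or> T = T2" for T c a
      using that assms by (auto simp: varies_def nodes_decreasing_tree table_inside)
    then show ?thesis using varies_iff_table[OF assms] by metis
  qed
  also have "\<dots> \<longleftrightarrow> (\<forall>c a. inv_table s T2 c a \<le> Suc (inv_table s T1 c a))"
    by (intro iff_allI) auto
  finally show ?thesis .
qed

lemma tree_ascent_nodes:
  assumes "decreasing_tree s n T" "tree_ascent s T a c"
  shows "a < c \<and> 1 \<le> a \<and> c \<le> n"
proof -
  obtain i where "in_child T c i a" using assms by (auto simp: tree_ascent_def descendant_def)
  then show ?thesis
    using in_child_nodes[of T c i a] assms nodes_decreasing_tree[OF assms(1)]
    by (auto simp: tree_ascent_def)
qed

text \<open>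
  Transitively closed tables are determined by their recursion, so \<open>R = T + A\<close> says exactly that
  the table of \<open>R\<close> satisfies the recursion for the table of \<open>T\<close> raised by one on \<open>A\<close>.
\<close>
lemma is_ascent_sum_iff_is_tc:
  assumes "decreasing_tree s n R" "finite A"
  shows "is_ascent_sum s n T A R \<longleftrightarrow>
    is_tc (\<lambda>c a. inv_table s T c a + of_bool ((a, c) \<in> A)) (inv_table s R)"
proof -
  let ?I = "tree_inversions s T + mset_set (prod.swap ` A)"
  have swap: "(c, a) \<in> prod.swap ` A \<longleftrightarrow> (a, c) \<in> A" for c a by force
  have "finite (prod.swap ` A)" using assms(2) by simp
  then have I: "(\<lambda>c a. count ?I (c, a)) = (\<lambda>c a. inv_table s T c a + of_bool ((a, c) \<in> A))"
    by (simp add: fun_eq_iff inv_table_def count_mset_set' swap)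
  have "is_ascent_sum s n T A R \<longleftrightarrow> tree_inversions s R = tclosure ?I"
    using assms(1) by (simp add: is_ascent_sum_def)
  also have "\<dots> \<longleftrightarrow> (\<forall>c a. inv_table s R c a = tc_mult ?I c a)"
    by (simp add: multiset_eq_iff inv_table_def count_tclosure)
  also have "\<dots> \<longleftrightarrow> is_tc (\<lambda>c a. count ?I (c, a)) (inv_table s R)"
  proof
    assume "\<forall>c a. inv_table s R c a = tc_mult ?I c a"
    then have "inv_table s R = tc_mult ?I" by blast
    then show "is_tc (\<lambda>c a. count ?I (c, a)) (inv_table s R)" using is_tc_tc_mult[of ?I] by simp
  qed (use is_tc_unique is_tc_tc_mult[of ?I] in blast)
  finally show ?thesis unfolding I .
qed

section \<open>Characterisation of pure intervals\<close>

theorem theorem3p9: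
  fixes s :: "nat \<Rightarrow> nat" and n :: nat and T1 T2 :: tree
  assumes "decreasing_tree s n T1" and "decreasing_tree s n T2"
    and "weak_le s T1 T2"
  shows "pure_interval s n T1 T2 \<longleftrightarrow>
    plus_one_interval s T1 T2 \<and>
    (\<forall>a b c v w. a < b \<and> b < c \<longrightarrow>
       ((c, a, v) \<in> Var s T1 T2 \<and> (b, a, w) \<in> Var s T1 T2 \<longrightarrow> (c, b, v) \<in> Var s T1 T2) \<and>
       ((c, a, v) \<in> EVar s T1 T2 \<and> (c, b, v) \<in> EVar s T1 T2 \<and> s b \<noteq> 0 \<longrightarrow>
          (b, a, 0) \<in> Var s T1 T2))"
    (is "_ \<longleftrightarrow> _ \<and> ?conditions")
proof -
  define x y where "x = inv_table s T1" and "y = inv_table s T2"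
  interpret X: inversion_table s x
    unfolding x_def using assms(1) by (rule inversion_table_inv_table)
  interpret Y: inversion_table s y
    unfolding y_def using assms(2) by (rule inversion_table_inv_table)
  note translate = Var_iff_table[OF assms(1,2), folded x_def y_def]
    EVar_iff_table[OF assms(1,2), folded x_def y_def]
    plus_one_interval_iff_table[OF assms(1,2), folded x_def y_def]
  have ascents: "tree_ascent s T1 a c \<Longrightarrow> X.ascent a c" for a c
    using tree_ascent_nodes[OF assms(1)] tree_ascent_iff_table[OF assms(1)] unfolding x_def by blast
  have finite: "finite A" if "\<And>a c. (a, c) \<in> A \<Longrightarrow> tree_ascent s T1 a c" for A
    by (rule finite_subset[of _ "{..n} \<times> {..n}"])
      (use that tree_ascent_nodes[OF assms(1)] in fastforce)+
  have le: "x c a \<le> y c a" for c a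
    using assms by (cases "a < c \<and> 1 \<le> a \<and> c \<le> n")
      (auto simp: x_def y_def table_inside table_outside weak_le_def nodes_decreasing_tree)
  show ?thesis
  proof (intro iffI conjI; (elim conjE)?)
    assume "pure_interval s n T1 T2"
    then obtain A where A: "\<And>a c. (a, c) \<in> A \<Longrightarrow> tree_ascent s T1 a c" "is_ascent_sum s n T1 A T2"
      by (auto simp: pure_interval_def)
    interpret ascent_closure s x y A
    proof
      show "X.ascent a c" if "(a, c) \<in> A" for a c using ascents A(1) that by blast
      show "is_tc (\<lambda>c a. x c a + of_bool ((a, c) \<in> A)) y"
        using is_ascent_sum_iff_is_tc[OF assms(2) finite[OF A(1)]] A(2) unfolding x_def y_def by blast
    qed
    have "y c a \<le> Suc (x c a)" for c a
      by (cases "x c a < y c a") (auto elim: variation_witness)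
    then show "plus_one_interval s T1 T2" unfolding translate by blast
    show ?conditions
    proof (intro allI impI conjI; elim conjE)
      fix a b c v w :: nat
      assume abc: "a < b" "b < c"
      show "(c, b, v) \<in> Var s T1 T2" if "(c, a, v) \<in> Var s T1 T2" "(b, a, w) \<in> Var s T1 T2"
        using condition1[OF abc] that unfolding translate by simp
      show "(b, a, 0) \<in> Var s T1 T2"
        if "(c, a, v) \<in> EVar s T1 T2" "(c, b, v) \<in> EVar s T1 T2" "s b \<noteq> 0"
        using condition2[OF abc] that unfolding translate by auto
    qed
  next
    assume plus_one: "plus_one_interval s T1 T2" and conditions: ?conditions
    interpret variation_conditions s x y
    proof
      fix a b c :: nat
      show "x c a \<le> y c a" by (rule le)
      show "y c a \<le> Suc (x c a)" using plus_one[unfolded translate] by blast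
      assume abc: "a < b" "b < c" and var: "x c a < y c a"
      show "x c b < y c b" if "x b a < y b a"
        using conditions[rule_format, of a b c "x c a" "x b a"] abc var that unfolding translate by simp
      show "x b a = 0 \<and> x b a < y b a"
        if "x c b < y c b" "x c a = x c b" "essential s x y c a" "essential s x y c b" "s b \<noteq> 0"
        using conditions[rule_format, of a b c "x c a" "x b a"] abc var that unfolding translate by auto
    qed
    define A where "A = {(a, c). x c a < y c a \<and> X.ascent a c}"
    have A: "tree_ascent s T1 a c" if "(a, c) \<in> A" for a c
    proof -
      have "x c a < y c a" "X.ascent a c" using that by (auto simp: A_def)
      moreover from this have "a < c" "1 \<le> a" "c \<le> n"
        using table_outside[OF assms(2), of a c] unfolding y_def by force+
      ultimately show ?thesis using tree_ascent_iff_table[OF assms(1)] unfolding x_def by blast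
    qed
    have "is_tc (\<lambda>c a. x c a + of_bool ((a, c) \<in> A)) y"
      using closure_of_varying_ascents by (simp add: A_def)
    then have "is_ascent_sum s n T1 A T2"
      using is_ascent_sum_iff_is_tc[OF assms(2) finite[OF A]] unfolding x_def y_def by blast
    with A show "pure_interval s n T1 T2" unfolding pure_interval_def by blast
  qed
qed

end
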